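(* Let $X$ be a complex Banach space, let $A:\operatorname{dom}(A)\subseteq X\to X$ and $B:\operatorname{dom}(B)\subseteq X\to X$ be closed linear operators with $\rho(B)\neq\emptyset$, and let $Y$ be a Banach space continuously embedded in $X$ such that $\operatorname{dom}(A)\subseteq\operatorname{dom}(B^2)\cap Y$, $B(\operatorname{dom}(A))\subseteq Y\subseteq\operatorname{dom}(B)$, and the operator $G=\begin{bmatrix}-B & I \\ A+B^2 & -B\end{bmatrix}$ with domain $\operatorname{dom}(A)\times Y$ generates a $C_0$-group $\{\mathcal T(t)\}_{t\in\mathbb R}$ on $Y\times X$. Let $M,\omega$ be constants with $\|\mathcal T(t)\|_{\mathcal B(Y\times X)}\le Me^{\omega|t|}$ for all $t\in\mathbb R$. Then there exists $\overline M>0$ such that for every $t\in\mathbb R$: for every $x\in X$: $\|S_{A,B}(t)x\|_Y\le\overline Me^{\omega|t|}\|x\|$, $\ \|BS_{A,B}(t)x\|\le\overline Me^{\omega|t|}\|x\|$, $\ \|S_{A,B}'(t)x\|\le\overline Me^{\omega|t|}\|x\|$; for every $y\in Y$: $\|BS_{A,B}(t)By\|\le\overline Me^{\omega|t|}\|y\|_Y$, $\ \|AS_{A,B}(t)y\|\le\overline Me^{\omega|t|}\|y\|_Y$, $\ \|S_{A,B}'(t)y\|_Y\le\overline Me^{\omega|t|}\|y\|_Y$, $\ \|C_{A,B}(t)y\|_Y\le\overline Me^{\omega|t|}\|y\|_Y$, $\ \|BC_{A,B}(t)y\|\le\overline Me^{\omega|t|}\|y\|_Y$, $\ \|C_{A,B}'(t)y\|\le\overline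 Me^{\omega|t|}\|y\|_Y$; for every $x\in\operatorname{dom}(B)$: $\|C_{A,B}(t)x\|\le\overline Me^{\omega|t|}\|x\|_{\operatorname{dom}(B)}$; for every $x\in\operatorname{dom}(A)$: $\|C_{A,B}'(t)x\|_Y\le Me^{\omega|t|}\|Ax\|$ and $\|AC_{A,B}(t)x\|\le\overline Me^{\omega|t|}\|Ax\|$.
   Context: $\|\cdot\|$ is the norm of $X$; $\|x\|_{\operatorname{dom}(B)}=\|x\|+\|Bx\|$; $Y\times X$ carries the norm $\|y\|_Y+\|x\|$. Write $\mathcal T(t)=\begin{bmatrix}T_{11}(t) & T_{12}(t) \\ T_{21}(t) & T_{22}(t)\end{bmatrix}$ in block form with respect to $Y\times X$. The generalized cosine and sine families $C_{A,B}(t)\in\mathcal B(\operatorname{dom}(B),X)$ and $S_{A,B}(t)\in\mathcal B(X)$ are given by $C_{A,B}(t)x=T_{22}(t)x-BT_{12}(t)x+2T_{12}(t)Bx$ for $x\in\operatorname{dom}(B)$ and $S_{A,B}(t)x=T_{12}(t)x$ for $x\in X$. It is known that $S_{A,B}(\cdot)x\in\mathcal C^1(\mathbb R,X)$ for $x\in X$ and $C_{A,B}(\cdot)y\in\mathcal C^1(\mathbb R,X)$ for $y\in Y$; $S_{A,B}'(t)x:=(S_{A,B}(t)x)'$ and $C_{A,B}'(t)y:=(C_{A,B}(t)y)'$ denote the (strong) derivatives in $X$. *)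

theory Defs
  imports "HOL-Analysis.Analysis"
begin

section \<open>Complex Banach spaces\<close>

class complex_normed_vector = real_normed_vector +
  fixes scaleC :: "complex \<Rightarrow> 'a \<Rightarrow> 'a" (infixr "*\<^sub>C" 75)
  assumes scaleC_add_right: "a *\<^sub>C (x + y) = a *\<^sub>C x + a *\<^sub>C y"
    and scaleC_add_left: "(a + b) *\<^sub>C x = a *\<^sub>C x + b *\<^sub>C x"
    and scaleC_scaleC: "a *\<^sub>C b *\<^sub>C x = (a * b) *\<^sub>C x"
    and scaleC_of_real: "complex_of_real r *\<^sub>C x = r *\<^sub>R x"
    and norm_scaleC: "norm (a *\<^sub>C x) = cmod a * norm x"

class cbanach = complex_normed_vector + banach

instantiation prod :: (complex_normed_vector, complex_normed_vector) complex_normed_vector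
begin

definition scaleC_prod_def: "c *\<^sub>C z = (c *\<^sub>C fst z, c *\<^sub>C snd z)"

instance
proof
  fix a b :: complex and x y :: "'a \<times> 'b" and r :: real
  show "a *\<^sub>C (x + y) = a *\<^sub>C x + a *\<^sub>C y"
    by (simp add: scaleC_prod_def scaleC_add_right)
  show "(a + b) *\<^sub>C x = a *\<^sub>C x + b *\<^sub>C x"
    by (simp add: scaleC_prod_def scaleC_add_left)
  show "a *\<^sub>C b *\<^sub>C x = (a * b) *\<^sub>C x"
    by (simp add: scaleC_prod_def scaleC_scaleC)
  show "complex_of_real r *\<^sub>C x = r *\<^sub>R x"
    by (simp add: scaleC_prod_def scaleC_of_real scaleR_prod_def)
  show "norm (a *\<^sub>C x) = cmod a * norm x"
    by (simp add: scaleC_prod_def norm_prod_def norm_scaleC power_mult_distrib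
        real_sqrt_mult flip: distrib_left)
qed

end

instance prod :: (cbanach, cbanach) cbanach ..

definition bounded_clinear :: "('a::complex_normed_vector \<Rightarrow> 'b::complex_normed_vector) \<Rightarrow> bool"
  where "bounded_clinear f \<longleftrightarrow> bounded_linear f \<and> (\<forall>c x. f (c *\<^sub>C x) = c *\<^sub>C f x)"


section \<open>Unbounded operators\<close>

text \<open>An operator with domain \<open>D\<close> is a pair of a set \<open>D\<close> and a total function;
  the values of the function outside \<open>D\<close> are irrelevant.\<close>

definition csubspace :: "'a::complex_normed_vector set \<Rightarrow> bool"
  where "csubspace D \<longleftrightarrow>
    0 \<in> D \<and> (\<forall>x\<in>D. \<forall>y\<in>D. x + y \<in> D) \<and> (\<forall>c. \<forall>x\<in>D. c *\<^sub>C x \<in> D)"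

definition clinear_operator ::
    "'a::complex_normed_vector set \<Rightarrow> ('a \<Rightarrow> 'b::complex_normed_vector) \<Rightarrow> bool"
  where "clinear_operator D A \<longleftrightarrow> csubspace D \<and>
    (\<forall>x\<in>D. \<forall>y\<in>D. A (x + y) = A x + A y) \<and> (\<forall>c. \<forall>x\<in>D. A (c *\<^sub>C x) = c *\<^sub>C A x)"

definition closed_operator ::
    "'a::complex_normed_vector set \<Rightarrow> ('a \<Rightarrow> 'b::complex_normed_vector) \<Rightarrow> bool"
  where "closed_operator D A \<longleftrightarrow> clinear_operator D A \<and> closed ((\<lambda>x. (x, A x)) ` D)"

definition resolvent_set :: "'a::complex_normed_vector set \<Rightarrow> ('a \<Rightarrow> 'a) \<Rightarrow> complex set"
  where "resolvent_set D B =
    {c. bij_betw (\<lambda>x. c *\<^sub>C x - B x) D UNIV \<and>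
        bounded_clinear (inv_into D (\<lambda>x. c *\<^sub>C x - B x))}"

definition square_domain :: "'a set \<Rightarrow> ('a \<Rightarrow> 'a) \<Rightarrow> 'a set"
  where "square_domain D B = {x \<in> D. B x \<in> D}"

definition graph_norm :: "('a::real_normed_vector \<Rightarrow> 'b::real_normed_vector) \<Rightarrow> 'a \<Rightarrow> real"
  where "graph_norm B x = norm x + norm (B x)"


section \<open>Groups of operators\<close>

definition C0_group :: "(real \<Rightarrow> 'a::complex_normed_vector \<Rightarrow> 'a) \<Rightarrow> bool"
  where "C0_group T \<longleftrightarrow>
    (\<forall>t. bounded_clinear (T t)) \<and>
    (\<forall>z. T 0 z = z) \<and> (\<forall>s t z. T (s + t) z = T s (T t z)) \<and>
    (\<forall>z. continuous_on UNIV (\<lambda>t. T t z))"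

definition generates_C0_group ::
    "'a::complex_normed_vector set \<Rightarrow> ('a \<Rightarrow> 'a) \<Rightarrow> (real \<Rightarrow> 'a \<Rightarrow> 'a) \<Rightarrow> bool"
  where "generates_C0_group D G T \<longleftrightarrow> C0_group T \<and>
    D = {z. \<exists>w. ((\<lambda>h. (T h z - z) /\<^sub>R h) \<longlongrightarrow> w) (at 0)} \<and>
    (\<forall>z\<in>D. ((\<lambda>h. (T h z - z) /\<^sub>R h) \<longlongrightarrow> G z) (at 0))"

text \<open>The library's norm on a product type is the Euclidean combination of the two norms.
  It is equivalent to the sum norm used here, so that continuity, boundedness and generators
  are the same for both, but the constant in a bound on the operator norm is not.\<close>

definition sum_norm :: "'a::real_normed_vector \<times> 'b::real_normed_vector \<Rightarrow> real"
  where "sum_norm z = norm (fst z) + norm (snd z)"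

definition sum_onorm ::
    "('a::real_normed_vector \<times> 'b::real_normed_vector \<Rightarrow> 'a \<times> 'b) \<Rightarrow> real"
  where "sum_onorm f = (SUP z. sum_norm (f z) / sum_norm z)"


section \<open>The embedded space\<close>

text \<open>The space \<open>Y\<close> is a type of its own, with an embedding \<open>J\<close> into the type of \<open>X\<close>;
  as a subset of \<open>X\<close> it is \<open>range J\<close>.\<close>

definition continuous_embedding ::
    "('y::complex_normed_vector \<Rightarrow> 'x::complex_normed_vector) \<Rightarrow> bool"
  where "continuous_embedding J \<longleftrightarrow> bounded_clinear J \<and> inj J"

text \<open>The \<open>Y\<close>-norm of an element of \<open>X\<close>; meaningful only on \<open>range J\<close>.\<close>

definition emb_norm :: "('y::real_normed_vector \<Rightarrow> 'x) \<Rightarrow> 'x \<Rightarrow> real"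
  where "emb_norm J x = norm (inv J x)"


section \<open>The block operator and the generalized cosine and sine families\<close>

definition G_domain :: "('y \<Rightarrow> 'x) \<Rightarrow> 'x set \<Rightarrow> ('y \<times> 'x) set"
  where "G_domain J domA = {(u, v). J u \<in> domA \<and> v \<in> range J}"

text \<open>For \<open>J u \<in> domA\<close> and \<open>v \<in> range J\<close>, the vector \<open>- B (J u) + v\<close> lies in \<open>range J\<close> as soon as
  \<open>B ` domA \<subseteq> range J\<close>, so \<open>inv J\<close> merely reads it as an element of \<open>Y\<close>.\<close>

definition G_op :: "('y \<Rightarrow> 'x::real_normed_vector) \<Rightarrow> ('x \<Rightarrow> 'x) \<Rightarrow> ('x \<Rightarrow> 'x) \<Rightarrow> 'y \<times> 'x \<Rightarrow> 'y \<times> 'x"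
  where "G_op J A B = (\<lambda>(u, v). (inv J (- B (J u) + v), A (J u) + B (B (J u)) - B v))"

definition block12 :: "('y::zero \<times> 'x \<Rightarrow> 'y \<times> 'x) \<Rightarrow> 'x \<Rightarrow> 'y"
  where "block12 L x = fst (L (0, x))"

definition block22 :: "('y::zero \<times> 'x \<Rightarrow> 'y \<times> 'x) \<Rightarrow> 'x \<Rightarrow> 'x"
  where "block22 L x = snd (L (0, x))"

definition gen_sine ::
    "('y::real_normed_vector \<Rightarrow> 'x::real_normed_vector) \<Rightarrow> (real \<Rightarrow> 'y \<times> 'x \<Rightarrow> 'y \<times> 'x) \<Rightarrow>
     real \<Rightarrow> 'x \<Rightarrow> 'x"
  where "gen_sine J T t x = J (block12 (T t) x)"

definition gen_cosine ::
    "('y::real_normed_vector \<Rightarrow> 'x::real_normed_vector) \<Rightarrow> ('x \<Rightarrow> 'x) \<Rightarrow>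
     (real \<Rightarrow> 'y \<times> 'x \<Rightarrow> 'y \<times> 'x) \<Rightarrow> real \<Rightarrow> 'x \<Rightarrow> 'x"
  where "gen_cosine J B T t x =
    block22 (T t) x - B (J (block12 (T t) x)) + 2 *\<^sub>R J (block12 (T t) (B x))"

end

theory Submission
  imports Defs
begin

text \<open>
  The generator maps \<open>(0, y)\<close> to \<open>(y, - B y)\<close> for \<open>y\<close> in \<open>Y\<close>, and \<open>(x, B x)\<close> to \<open>(0, A x)\<close> for \<open>x\<close> in
  \<open>dom(A)\<close>. Since \<open>G\<close> commutes with \<open>T(t)\<close>, comparing the two components expresses \<open>S'(t) y\<close> and
  \<open>A S(t) y\<close> through \<open>T(t) (y, - B y)\<close>, and \<open>C'(t) x\<close> and \<open>A C(t) x\<close> through \<open>T(t) (0, A x)\<close>; moreover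
  \<open>C(t) y\<close> is the first component of \<open>T(t) (y, B y)\<close>. All estimates then follow from the growth
  bound, because \<open>B\<close> is bounded from \<open>Y\<close> to \<open>X\<close> by the closed graph theorem.
\<close>

text \<open>By the Baire category theorem, the closure of some sublevel set of
  \<open>norm (f x)\<close> contains a ball. Hence each nonzero vector is approximated up to half
  its norm by a vector on which \<open>f\<close> is controlled, and iterating this bounds
  \<open>f\<close>.\<close>

theorem closed_graph_imp_bounded_linear:
  fixes f :: "'a::banach \<Rightarrow> 'b::banach"
  assumes lin: "linear f" and graph: "closed (range (\<lambda>x. (x, f x)))"
  shows "bounded_linear f"
proof -
  interpret f: linear f by (rule lin)
  define W where "W n = closure {x. norm (f x) \<le> real n}" for n :: nat
  have "\<exists>n. interior (W n) \<noteq> {}"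
  proof (rule ccontr)
    assume "\<not> ?thesis"
    then have "euclidean interior_of \<Union>(range W) = {}"
      by (intro Baire_category_alt)
        (auto simp: W_def completely_metrizable_space_euclidean simp del: interior_of_eq_empty)
    moreover have "\<Union>(range W) = UNIV"
      using real_arch_simple closure_subset unfolding W_def by fastforce
    ultimately show False by simp
  qed
  then obtain n a e where e: "e > 0" and ball: "ball a e \<subseteq> W n"
    by (meson equals0I mem_interior)
  \<comment> \<open>Scaling a vector of norm at most \<open>r\<close> by \<open>e / (2 * r)\<close>
    moves it into the ball of radius \<open>e\<close> about \<open>0\<close>; undoing the scaling
    turns the bound \<open>2 * real n\<close> of \<open>small\<close> into
    \<open>L * r\<close>.\<close>
  define L where "L = 2 * (2 * real n) / e"
  have L: "L \<ge> 0" using e by (simp add: L_def)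
  \<comment> \<open>Both \<open>a + y\<close> and \<open>a\<close> are limits of points where
    \<open>norm (f x)\<close> is at most \<open>real n\<close>; a difference of two such points
    comes close to \<open>y\<close> and at most doubles the bound.\<close>
  have small: "\<exists>x. norm (f x) \<le> 2 * real n \<and> norm (y - x) < d" if y: "norm y < e" and d: "d > 0" for y d
  proof -
    have "a + y \<in> W n" "a \<in> W n"
      using ball y e by (auto simp: subset_iff dist_norm)
    then obtain u v where u: "norm (f u) \<le> n" "dist u (a + y) < d / 2"
      and v: "norm (f v) \<le> n" "dist v a < d / 2"
      using d unfolding W_def closure_approachable by (metis half_gt_zero mem_Collect_eq)
    have "norm (f (u - v)) \<le> 2 * real n"
      using norm_triangle_ineq4[of "f u" "f v"] u(1) v(1) by (simp add: f.diff)
    moreover have "norm (y - (u - v)) < d"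
    proof -
      have "norm (y - (u - v)) = norm ((v - a) - (u - (a + y)))"
        by (simp add: algebra_simps)
      also have "\<dots> \<le> dist v a + dist u (a + y)"
        unfolding dist_norm by (rule norm_triangle_ineq4)
      also have "\<dots> < d" using u(2) v(2) by linarith
      finally show ?thesis .
    qed
    ultimately show ?thesis by blast
  qed
  have approx: "\<exists>x. norm (f x) \<le> L * r \<and> norm (y - x) \<le> r / 2" if y: "norm y \<le> r" and r: "r > 0" for y r
  proof -
    define c where "c = e / (2 * r)"
    have c: "c > 0" using e r by (simp add: c_def)
    have "norm (c *\<^sub>R y) \<le> c * r"
      using y c by simp
    also have "\<dots> < e" using e r by (simp add: c_def)
    finally obtain x where x: "norm (f x) \<le> 2 * real n" "norm (c *\<^sub>R y - x) < c * r / 2"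
      using small[of "c *\<^sub>R y" "c * r / 2"] c r by auto
    have "y - x /\<^sub>R c = (c *\<^sub>R y - x) /\<^sub>R c"
      using c by (simp add: scaleR_diff_right)
    then have "norm (y - x /\<^sub>R c) = norm (c *\<^sub>R y - x) / c"
      using c by (simp add: divide_inverse mult.commute)
    also have "\<dots> \<le> r / 2"
      using x(2) c by (simp add: field_simps)
    finally have "norm (y - x /\<^sub>R c) \<le> r / 2" .
    moreover have "norm (f (x /\<^sub>R c)) = norm (f x) / c"
      using c by (simp add: f.scale divide_inverse mult.commute)
    moreover have "\<dots> \<le> 2 * real n / c"
      using x(1) c by (intro divide_right_mono) auto
    moreover have "2 * real n / c = L * r"
      using e r by (simp add: c_def L_def)
    ultimately show ?thesis by metis
  qed
  then obtain g where g: "\<And>y r. norm y \<le> r \<Longrightarrow> r > 0 \<Longrightarrow> norm (f (g y r)) \<le> L * r \<and> norm (y - g y r) \<le> r / 2"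
    by metis
  \<comment> \<open>The remainders \<open>z k\<close> of successive approximation tend to \<open>0\<close> while \<open>f (z k)\<close> converges;
    closedness of the graph forces the limit to be \<open>f 0\<close>.\<close>
  have bound: "norm (f y) \<le> 2 * L * norm y" if "y \<noteq> 0" for y
  proof -
    define r where "r = norm y"
    have r: "r > 0" using that by (simp add: r_def)
    define z where "z = rec_nat y (\<lambda>k w. w - g w (r / 2 ^ k))"
    have z0: "z 0 = y" and zS: "z (Suc k) = z k - g (z k) (r / 2 ^ k)" for k
      by (simp_all add: z_def)
    have z: "norm (z k) \<le> r / 2 ^ k" for k
    proof (induction k)
      case 0 then show ?case by (simp add: z0 r_def)
    next
      case (Suc k)
      then show ?case using g[OF Suc] r by (simp add: zS field_simps)
    qed
    \<comment> \<open>The increments of \<open>f (z k)\<close> are at most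
      \<open>L * (r / 2 ^ k)\<close>; the sum of this geometric majorant is the source of the
      constant \<open>2 * L\<close>.\<close>
    have geo: "(\<lambda>k. L * r * (1 / 2) ^ k) sums (L * r * 2)"
      using sums_mult[OF geometric_sums[of "1/2::real"], of "L * r"] by simp
    have d: "norm (f (z (Suc k)) - f (z k)) \<le> L * r * (1 / 2) ^ k" for k
      using g[OF z[of k]] r by (simp add: zS f.diff power_one_over)
    have sm: "summable (\<lambda>k. f (z (Suc k)) - f (z k))"
      by (rule summable_comparison_test'[OF sums_summable[OF geo], of 0]) (rule d)
    then have "(\<lambda>k. (f (z k) - f y) + f y) \<longlonglongrightarrow> suminf (\<lambda>k. f (z (Suc k)) - f (z k)) + f y"
      using summable_LIMSEQ[OF sm] by (intro tendsto_intros) (simp add: sum_lessThan_telescope[of "\<lambda>k. f (z k)"] z0)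
    then have "(\<lambda>k. f (z k)) \<longlonglongrightarrow> suminf (\<lambda>k. f (z (Suc k)) - f (z k)) + f y"
      by simp
    moreover have "z \<longlonglongrightarrow> 0"
    proof (rule tendsto_norm_zero_cancel, rule tendsto_sandwich[of "\<lambda>_. 0"])
      show "(\<lambda>k. r / 2 ^ k) \<longlonglongrightarrow> 0"
        by (rule LIMSEQ_divide_realpow_zero) simp
    qed (use z in auto)
    ultimately have "(\<lambda>k. (z k, f (z k))) \<longlonglongrightarrow> (0, suminf (\<lambda>k. f (z (Suc k)) - f (z k)) + f y)"
      by (intro tendsto_Pair)
    then have "(0, suminf (\<lambda>k. f (z (Suc k)) - f (z k)) + f y) \<in> range (\<lambda>x. (x, f x))"
      by (rule closed_sequentially[OF graph, rotated]) auto
    then have "f y = - suminf (\<lambda>k. f (z (Suc k)) - f (z k))"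
      by (auto simp: f.zero eq_neg_iff_add_eq_0 add.commute)
    moreover have "norm (suminf (\<lambda>k. f (z (Suc k)) - f (z k))) \<le> L * r * 2"
      using norm_suminf_le[OF d sums_summable[OF geo]] sums_unique[OF geo] by simp
    ultimately show ?thesis by (simp add: r_def mult.commute mult.left_commute)
  qed
  show ?thesis
    by (rule bounded_linear_intro[of _ "2 * L"])
      (use bound f.zero in \<open>force simp: f.add f.scale mult.commute\<close>)+
qed

text \<open>Generators are defined by difference quotients at \<open>0\<close>; this puts
  derivatives into the same form.\<close>

lemma has_vector_derivative_at_iff:
  fixes f :: "real \<Rightarrow> 'a::real_normed_vector"
  shows "(f has_vector_derivative f') (at x) \<longleftrightarrow> ((\<lambda>h. (f (x + h) - f x) /\<^sub>R h) \<longlongrightarrow> f') (at 0)"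
proof -
  have "(f has_vector_derivative f') (at x) \<longleftrightarrow>
      ((\<lambda>h. norm (f (x + h) - f x - h *\<^sub>R f') / norm h) \<longlongrightarrow> 0) (at 0)"
    unfolding has_vector_derivative_def has_derivative_at by (simp add: bounded_linear_scaleR_left)
  also have "\<dots> \<longleftrightarrow> ((\<lambda>h. norm ((f (x + h) - f x) /\<^sub>R h - f')) \<longlongrightarrow> 0) (at 0)"
  proof (rule tendsto_cong, rule eventually_at_filter[THEN iffD2], rule always_eventually, safe)
    fix h :: real assume "h \<noteq> 0"
    then have "(f (x + h) - f x) /\<^sub>R h - f' = (f (x + h) - f x - h *\<^sub>R f') /\<^sub>R h"
      by (simp add: scaleR_diff_right)
    then show "norm (f (x + h) - f x - h *\<^sub>R f') / norm h = norm ((f (x + h) - f x) /\<^sub>R h - f')"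
      by (simp add: divide_inverse mult.commute)
  qed
  finally show ?thesis
    by (simp only: tendsto_norm_zero_iff LIM_zero_iff)
qed

text \<open>\<open>T t\<close> is continuous and commutes with every \<open>T h\<close>, so it can
  be pulled through the difference quotient at \<open>z\<close>.\<close>

lemma generator_commute:
  assumes gen: "generates_C0_group D G T" and z: "z \<in> D"
  shows "T t z \<in> D" and "G (T t z) = T t (G z)"
proof -
  from gen have bl: "bounded_linear (T t)" and hom: "\<And>s t z. T (s + t) z = T s (T t z)"
    and lim: "\<And>z. z \<in> D \<Longrightarrow> ((\<lambda>h. (T h z - z) /\<^sub>R h) \<longlongrightarrow> G z) (at 0)"
    and D: "D = {z. \<exists>w. ((\<lambda>h. (T h z - z) /\<^sub>R h) \<longlongrightarrow> w) (at 0)}"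
    unfolding generates_C0_group_def C0_group_def bounded_clinear_def by blast+
  interpret T: bounded_linear "T t" by (rule bl)
  have "((\<lambda>h. T t ((T h z - z) /\<^sub>R h)) \<longlongrightarrow> T t (G z)) (at 0)"
    by (intro T.tendsto lim z)
  also have "(\<lambda>h. T t ((T h z - z) /\<^sub>R h)) = (\<lambda>h. (T h (T t z) - T t z) /\<^sub>R h)"
    by (simp add: T.scaleR T.diff hom[symmetric] add.commute)
  finally have l: "((\<lambda>h. (T h (T t z) - T t z) /\<^sub>R h) \<longlongrightarrow> T t (G z)) (at 0)" .
  then show "T t z \<in> D" by (auto simp: D)
  then show "G (T t z) = T t (G z)"
    using tendsto_unique[OF _ lim l] by simp
qed

text \<open>For an antiderivative \<open>F\<close> of the orbit, \<open>T h\<close> shifts the increments of \<open>F\<close> by \<open>h\<close>,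
  because both sides have the same derivative.\<close>

lemma orbit_antiderivative:
  fixes T :: "real \<Rightarrow> 'a::cbanach \<Rightarrow> 'a"
  assumes gen: "generates_C0_group D G T"
  obtains F where "(F has_vector_derivative T t z) (at t)"
    and "\<forall>\<^sub>F s in nhds t. F s - F t \<in> D \<and> G (F s - F t) = T s z - T t z"
proof -
  from gen have bl: "\<And>t. bounded_linear (T t)" and hom: "\<And>s t z. T (s + t) z = T s (T t z)"
    and cont: "continuous_on UNIV (\<lambda>t. T t z)"
    and lim: "\<And>z. z \<in> D \<Longrightarrow> ((\<lambda>h. (T h z - z) /\<^sub>R h) \<longlongrightarrow> G z) (at 0)"
    and D: "D = {z. \<exists>w. ((\<lambda>h. (T h z - z) /\<^sub>R h) \<longlongrightarrow> w) (at 0)}"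
    unfolding generates_C0_group_def C0_group_def bounded_clinear_def by blast+
  \<comment> \<open>Radius 2 leaves room for \<open>s + h\<close> when both \<open>s - t\<close> and
    \<open>h\<close> have absolute value below 1.\<close>
  obtain F where F0: "\<And>s. s \<in> {t-2..t+2} \<Longrightarrow> (F has_vector_derivative T s z) (at s within {t-2..t+2})"
    using antiderivative_continuous continuous_on_subset[OF cont subset_UNIV] by blast
  have F: "(F has_vector_derivative T s z) (at s)" if "\<bar>s - t\<bar> < 2" for s
  proof -
    from that have "at s within {t-2..t+2} = at s" by (intro at_within_Icc_at) (auto simp: abs_less_iff)
    then show ?thesis using F0[of s] that by (simp add: abs_less_iff)
  qed
  have "F s - F t \<in> D \<and> G (F s - F t) = T s z - T t z" if s: "\<bar>s - t\<bar> < 1" for s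
  proof -
    have shift: "T h (F s - F t) = F (s + h) - F (t + h)" if h: "\<bar>h\<bar> < 1" for h
    proof -
      have "((\<lambda>u. T h (F u) - F (u + h)) has_vector_derivative 0) (at u)" if "\<bar>u - t\<bar> < 1" for u
      proof -
        have "((\<lambda>u. T h (F u)) has_vector_derivative T h (T u z)) (at u)"
          using that by (intro bounded_linear.has_vector_derivative[OF bl] F) auto
        moreover have "((\<lambda>u. F (u + h)) has_vector_derivative T (u + h) z) (at u)"
          using F[of "u + h"] that h by (simp add: has_vector_derivative_at_iff ac_simps)
        ultimately show ?thesis
          using has_vector_derivative_diff by (fastforce simp: hom[symmetric] add.commute)
      qed
      then have "T h (F s) - F (s + h) = T h (F t) - F (t + h)"
        using s by (intro has_derivative_zero_unique[of "ball t 1"])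
          (auto simp: has_vector_derivative_def dist_real_def abs_minus_commute intro: has_derivative_at_withinI)
      then show ?thesis
        by (simp add: linear_diff[OF bounded_linear.linear[OF bl]] algebra_simps)
    qed
    \<comment> \<open>By \<open>shift\<close>, the generator quotient at \<open>F s - F t\<close> is
      a difference of two quotients of \<open>F\<close>, whose limits are the derivatives of
      \<open>F\<close> at \<open>s\<close> and \<open>t\<close>.\<close>
    have "((\<lambda>h. (F (s + h) - F s) /\<^sub>R h - (F (t + h) - F t) /\<^sub>R h) \<longlongrightarrow> T s z - T t z) (at 0)"
      using s by (intro tendsto_diff F[unfolded has_vector_derivative_at_iff]) auto
    moreover have "\<forall>\<^sub>F h in at 0. (F (s + h) - F s) /\<^sub>R h - (F (t + h) - F t) /\<^sub>R h
        = (T h (F s - F t) - (F s - F t)) /\<^sub>R h"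
      unfolding eventually_at
      by (rule exI[of _ 1]) (simp add: shift scaleR_diff_right)
    ultimately have l: "((\<lambda>h. (T h (F s - F t) - (F s - F t)) /\<^sub>R h) \<longlongrightarrow> T s z - T t z) (at 0)"
      by (simp cong: tendsto_cong)
    then have "F s - F t \<in> D" by (auto simp: D)
    then show ?thesis using tendsto_unique[OF _ lim l] by simp
  qed
  then have "\<forall>\<^sub>F s in nhds t. F s - F t \<in> D \<and> G (F s - F t) = T s z - T t z"
    unfolding eventually_nhds_metric dist_real_def by (meson zero_less_one)
  then show ?thesis by (intro that[OF F[of t]]) simp_all
qed

text \<open>The supremum defining \<open>sum_onorm\<close> dominates its quotients once they are
  bounded above. They are, because the Euclidean norm and the sum norm on the product are
  equivalent.\<close>

lemma
  fixes f :: "'a::real_normed_vector \<times> 'b::real_normed_vector \<Rightarrow> 'a \<times> 'b"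
  assumes "bounded_linear f"
  shows sum_onorm_nonneg: "0 \<le> sum_onorm f"
    and sum_onorm_bound: "sum_norm (f z) \<le> sum_onorm f * sum_norm z"
proof -
  have up: "sum_norm w \<le> 2 * norm w" for w :: "'a \<times> 'b"
    unfolding sum_norm_def using norm_fst_le[of "fst w" "snd w"] norm_snd_le[of "snd w" "fst w"] by simp
  have lo: "norm w \<le> sum_norm w" for w :: "'a \<times> 'b"
    unfolding sum_norm_def norm_prod_def by (rule sqrt_sum_squares_le_sum) auto
  have nz: "sum_norm w \<ge> 0" for w :: "'a \<times> 'b" by (simp add: sum_norm_def)
  obtain K where K: "K > 0" "\<And>w. norm (f w) \<le> norm w * K"
    using bounded_linear.pos_bounded[OF assms] by blast
  have "sum_norm (f w) / sum_norm w \<le> 2 * K" for w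
  proof -
    have "sum_norm (f w) \<le> 2 * (norm w * K)" using up[of "f w"] K(2)[of w] by linarith
    also have "\<dots> \<le> 2 * K * sum_norm w"
      using mult_left_mono[OF lo[of w], of K] K(1) by (simp add: mult.commute)
    finally show ?thesis using nz[of w] K(1) by (cases "sum_norm w = 0") (auto simp: divide_simps)
  qed
  then have "bdd_above (range (\<lambda>w. sum_norm (f w) / sum_norm w))"
    by (intro bdd_aboveI) auto
  then have quot: "sum_norm (f w) / sum_norm w \<le> sum_onorm f" for w
    unfolding sum_onorm_def by (rule cSUP_upper[OF UNIV_I])
  \<comment> \<open>Division by zero yields \<open>0\<close>, so the quotient at the zero vector is
    \<open>0\<close>.\<close>
  show "0 \<le> sum_onorm f"
    using quot[of 0] by (simp add: sum_norm_def)
  show "sum_norm (f z) \<le> sum_onorm f * sum_norm z"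
  proof (cases "z = 0")
    case True
    then show ?thesis
      by (simp add: sum_norm_def linear_0[OF bounded_linear.linear[OF assms]])
  next
    case False
    then have "sum_norm z > 0"
      using lo[of z] by (smt (verit) zero_less_norm_iff)
    then show ?thesis using quot[of z] by (simp add: pos_divide_le_eq)
  qed
qed

theorem lemma4p6:
  fixes domA domB :: "'x::cbanach set"
    and A B :: "'x \<Rightarrow> 'x"
    and J :: "'y::cbanach \<Rightarrow> 'x"
    and T :: "real \<Rightarrow> 'y \<times> 'x \<Rightarrow> 'y \<times> 'x"
    and M \<omega> :: real
  defines "S \<equiv> gen_sine J T"
    and "C \<equiv> gen_cosine J B T"
  defines "S' \<equiv> (\<lambda>t x. vector_derivative (\<lambda>s. S s x) (at t))"
    and "C' \<equiv> (\<lambda>t x. vector_derivative (\<lambda>s. C s x) (at t))"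
  assumes "closed_operator domA A"
    and "closed_operator domB B"
    and "resolvent_set domB B \<noteq> {}"
    and "continuous_embedding J"
    and "domA \<subseteq> square_domain domB B \<inter> range J"
    and "B ` domA \<subseteq> range J"
    and "range J \<subseteq> domB"
    and "generates_C0_group (G_domain J domA) (G_op J A B) T"
    and "\<And>t. sum_onorm (T t) \<le> M * exp (\<omega> * \<bar>t\<bar>)"
  shows "\<exists>M'>0. \<forall>t.
    (\<forall>x. S t x \<in> range J \<and> emb_norm J (S t x) \<le> M' * exp (\<omega> * \<bar>t\<bar>) * norm x \<and>
         norm (B (S t x)) \<le> M' * exp (\<omega> * \<bar>t\<bar>) * norm x \<and>
         (\<lambda>s. S s x) differentiable (at t) \<and>
         norm (S' t x) \<le> M' * exp (\<omega> * \<bar>t\<bar>) * norm x) \<and>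
    (\<forall>y\<in>range J.
         norm (B (S t (B y))) \<le> M' * exp (\<omega> * \<bar>t\<bar>) * emb_norm J y \<and>
         S t y \<in> domA \<and> norm (A (S t y)) \<le> M' * exp (\<omega> * \<bar>t\<bar>) * emb_norm J y \<and>
         S' t y \<in> range J \<and> emb_norm J (S' t y) \<le> M' * exp (\<omega> * \<bar>t\<bar>) * emb_norm J y \<and>
         C t y \<in> range J \<and> emb_norm J (C t y) \<le> M' * exp (\<omega> * \<bar>t\<bar>) * emb_norm J y \<and>
         norm (B (C t y)) \<le> M' * exp (\<omega> * \<bar>t\<bar>) * emb_norm J y \<and>
         (\<lambda>s. C s y) differentiable (at t) \<and>
         norm (C' t y) \<le> M' * exp (\<omega> * \<bar>t\<bar>) * emb_norm J y) \<and>
    (\<forall>x\<in>domB. norm (C t x) \<le> M' * exp (\<omega> * \<bar>t\<bar>) * graph_norm B x) \<and>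
    (\<forall>x\<in>domA.
         C' t x \<in> range J \<and> emb_norm J (C' t x) \<le> M * exp (\<omega> * \<bar>t\<bar>) * norm (A x) \<and>
         C t x \<in> domA \<and> norm (A (C t x)) \<le> M' * exp (\<omega> * \<bar>t\<bar>) * norm (A x))"
proof -

  \<comment> \<open>The embedding and the group as bounded linear maps\<close>
  note clA = assms(5) and clB = assms(6) and emb = assms(8) and domA = assms(9)
    and BdomA = assms(10) and YdomB = assms(11) and gen = assms(12) and growth = assms(13)
  let ?D = "G_domain J domA" and ?G = "G_op J A B"
  have J: "bounded_linear J" "inj J" and invJ [simp]: "\<And>u. inv J (J u) = u"
    using emb by (auto simp: continuous_embedding_def bounded_clinear_def)
  interpret J: bounded_linear J by (rule J)
  have T: "bounded_linear (T t)" for t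
    using gen by (simp add: generates_C0_group_def C0_group_def bounded_clinear_def)
  interpret T: bounded_linear "T t" for t by (rule T)

  \<comment> \<open>Boundedness of \<open>B\<close> from Y to X\<close>
  have "0 \<in> domA" and A0: "A 0 = 0"
    using clA scaleC_of_real[of 0 "A 0"] scaleC_of_real[of 0 "0::'x"]
    by (auto simp: closed_operator_def clinear_operator_def csubspace_def dest!: spec[of _ 0])
  have Badd: "B (x + y) = B x + B y" if "x \<in> domB" "y \<in> domB" for x y
    using clB that by (simp add: closed_operator_def clinear_operator_def)
  have Bscale: "B (r *\<^sub>R x) = r *\<^sub>R B x" if "x \<in> domB" for x r
    using clB that unfolding closed_operator_def clinear_operator_def
    by (simp flip: scaleC_of_real)
  have JdomB: "J u \<in> domB" for u using YdomB by blast
  have BJ: "bounded_linear (\<lambda>u. B (J u))"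
  proof (rule closed_graph_imp_bounded_linear)
    show "linear (\<lambda>u. B (J u))"
      by (rule linearI) (simp_all add: J.add J.scale Badd Bscale JdomB)
    \<comment> \<open>The graph of \<open>B\<close> composed with \<open>J\<close> is the preimage
      of the closed graph of \<open>B\<close> under a continuous map.\<close>
    have "closed ((\<lambda>z. (J (fst z), snd z)) -` (\<lambda>x. (x, B x)) ` domB)"
      using clB by (intro closed_vimage) (auto simp: closed_operator_def intro!: continuous_intros J.continuous_on)
    also have "(\<lambda>z. (J (fst z), snd z)) -` (\<lambda>x. (x, B x)) ` domB = range (\<lambda>u. (u, B (J u)))"
      using JdomB by (auto simp: image_iff)
    finally show "closed (range (\<lambda>u. (u, B (J u))))" .
  qed
  interpret BJ: bounded_linear "\<lambda>u. B (J u)" by (rule BJ)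
  have B0: "B 0 = 0" using BJ.zero by (simp add: J.zero)
  obtain K where K: "K > 0" and JK: "\<And>u. norm (J u) \<le> K * norm u" and BK: "\<And>u. norm (B (J u)) \<le> K * norm u"
  proof -
    obtain K1 K2 where K: "K1 > 0" "\<And>u. norm (J u) \<le> norm u * K1" "K2 > 0" "\<And>u. norm (B (J u)) \<le> norm u * K2"
      using J.pos_bounded BJ.pos_bounded by metis
    have "norm (J u) \<le> (K1 + K2) * norm u \<and> norm (B (J u)) \<le> (K1 + K2) * norm u" for u
      using K(1,3) K(2,4)[of u]
      by (auto simp: algebra_simps intro: add_increasing add_increasing2)
    then show ?thesis using that[of "K1 + K2"] K(1,3) by auto
  qed

  \<comment> \<open>The growth bound, componentwise\<close>
  define E where "E t = M * exp (\<omega> * \<bar>t\<bar>)" for t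
  have TE: "norm (fst (T t z)) + norm (snd (T t z)) \<le> E t * (norm (fst z) + norm (snd z))" for t z
    using order_trans[OF sum_onorm_bound[OF T, of t z] mult_right_mono[OF growth[of t], of "sum_norm z"]]
    by (simp add: sum_norm_def E_def)
  \<comment> \<open>The sign of \<open>M\<close> comes from the growth bound, as
    \<open>sum_onorm\<close> is nonnegative.\<close>
  have E0: "0 \<le> E t" for t
    using order_trans[OF sum_onorm_nonneg[OF T] growth[of t]] by (simp add: E_def)

  \<comment> \<open>Rows of the generator and differentiability of the first component\<close>
  have fstG: "J (fst (?G w)) = snd w - B (J (fst w))" if w: "w \<in> ?D" for w
  proof -
    \<comment> \<open>Both vectors have preimages under \<open>J\<close>, so \<open>inv J\<close> in
      \<open>G_op\<close> acts as a true inverse here.\<close>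
    obtain b c where "B (J (fst w)) = J b" "snd w = J c"
      using w BdomA by (auto simp: G_domain_def)
    then have "- B (J (fst w)) + snd w = J (c - b)"
      by (simp add: J.diff)
    then show ?thesis using \<open>B (J (fst w)) = J b\<close> \<open>snd w = J c\<close>
      by (simp add: G_op_def case_prod_beta flip: J.diff)
  qed
  have sndG: "snd (?G w) = A (J (fst w)) + B (B (J (fst w))) - B (snd w)" for w
    by (simp add: G_op_def case_prod_beta)
  \<comment> \<open>Here \<open>z\<close> is arbitrary, so the orbit is reached through its
    antiderivative \<open>F\<close>: the increment \<open>T s z - T t z\<close> is the generator at
    \<open>F s - F t\<close>. The first row of the generator, read in X, is a bounded operator on
    the product, since \<open>B\<close> is bounded on Y; it therefore carries the derivative of
    \<open>F\<close> over.\<close>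
  have deriv: "((\<lambda>s. J (fst (T s z))) has_vector_derivative snd (T t z) - B (J (fst (T t z)))) (at t)" for z t
  proof -
    obtain F where F: "(F has_vector_derivative T t z) (at t)"
      and ev: "\<forall>\<^sub>F s in nhds t. F s - F t \<in> ?D \<and> ?G (F s - F t) = T s z - T t z"
      using orbit_antiderivative[OF gen] by blast
    define R where "R s = J (fst (T t z)) + (snd (F s - F t) - B (J (fst (F s - F t))))" for s
    have R: "\<forall>\<^sub>F s in nhds t. J (fst (T s z)) = R s"
      using ev
    proof eventually_elim
      case (elim s)
      then have "J (fst (T s z - T t z)) = snd (F s - F t) - B (J (fst (F s - F t)))"
        using fstG[of "F s - F t"] by metis
      then show ?case by (simp add: R_def J.diff algebra_simps)
    qed
    moreover have "(R has_vector_derivative snd (T t z) - B (J (fst (T t z)))) (at t)"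
    proof -
      have "bounded_linear (\<lambda>w. snd w - B (J (fst w)))"
        by (intro bounded_linear_sub bounded_linear_snd bounded_linear_compose[OF BJ] bounded_linear_fst)
      moreover have "((\<lambda>s. F s - F t) has_vector_derivative T t z) (at t)"
        using F has_vector_derivative_diff_const by blast
      ultimately have "((\<lambda>s. snd (F s - F t) - B (J (fst (F s - F t)))) has_vector_derivative
          snd (T t z) - B (J (fst (T t z)))) (at t)"
        by (rule bounded_linear.has_vector_derivative)
      from has_vector_derivative_add[OF has_vector_derivative_const this] show ?thesis
        by (simp add: R_def[abs_def])
    qed
    ultimately show ?thesis
      using has_vector_derivative_cong_ev[of UNIV "\<lambda>s. J (fst (T s z))" R t]
        eventually_nhds_x_imp_x[OF R] by simp
  qed

  \<comment> \<open>The families and their derivatives on Y\<close>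
  have S: "S t x = J (fst (T t (0, x)))" for t x
    by (simp add: S_def gen_sine_def block12_def)
  have C: "C t x = snd (T t (0, x)) - B (J (fst (T t (0, x)))) + 2 *\<^sub>R J (fst (T t (0, B x)))" for t x
    by (simp add: C_def gen_cosine_def block12_def block22_def)
  have S': "S' t x = snd (T t (0, x)) - B (J (fst (T t (0, x))))"
    and Sdiff: "(\<lambda>s. S s x) differentiable (at t)" for t x
    using deriv[of "(0, x)" t] unfolding S'_def S
    by (auto intro: vector_derivative_at differentiableI_vector)
  have YD: "(0, J u) \<in> ?D" for u
    using \<open>0 \<in> domA\<close> by (simp add: G_domain_def J.zero)
  have G0: "?G (0, J u) = (u, - B (J u))" for u
    by (simp add: G_op_def J.zero A0 B0)
  have YT: "T t (0, J u) \<in> ?D" "?G (T t (0, J u)) = T t (u, - B (J u))" for t u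
    using generator_commute[OF gen YD, of t u] G0 by simp_all
  have S'Y: "S' t (J u) = J (fst (T t (u, - B (J u))))" for t u
    using fstG[OF YT(1)[of t u]] by (simp add: S' YT(2))
  \<comment> \<open>By definition \<open>C t y\<close> is
    \<open>S' t y + 2 *\<^sub>R S t (B y)\<close>, and adding twice \<open>(0, B y)\<close> to
    \<open>(y, - B y)\<close> flips the sign of its second entry.\<close>
  have CY: "C t (J u) = J (fst (T t (u, B (J u))))" for t u
  proof -
    have "T t (u, B (J u)) = T t (u, - B (J u)) + 2 *\<^sub>R T t (0, B (J u))"
      by (simp add: scaleR_2 flip: T.add T.scaleR)
    then have "J (fst (T t (u, B (J u)))) = S' t (J u) + 2 *\<^sub>R J (fst (T t (0, B (J u))))"
      by (simp add: S'Y J.add J.scale)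
    then show ?thesis by (simp add: C S')
  qed
  have C'Y: "C' t (J u) = snd (T t (u, B (J u))) - B (J (fst (T t (u, B (J u)))))"
    and Cdiff: "(\<lambda>s. C s (J u)) differentiable (at t)" for t u
    using deriv[of "(u, B (J u))" t] unfolding C'_def CY
    by (auto intro: vector_derivative_at differentiableI_vector)
  \<comment> \<open>The first row writes \<open>snd ?w\<close> as a sum with summand
    \<open>B (J (fst ?w))\<close>, so the terms with the square of \<open>B\<close> cancel in the
    second row. Splitting \<open>B\<close> over that sum relies on \<open>domA\<close> lying in the
    domain of the square.\<close>
  have ASY: "A (S t (J u)) = snd (T t (u, - B (J u))) + B (J (fst (T t (u, - B (J u)))))" for t u
  proof -
    let ?w = "T t (0, J u)" and ?v = "T t (u, - B (J u))"
    have mem: "J (fst ?w) \<in> domA" using YT(1)[of t u] by (auto simp: G_domain_def)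
    have "snd ?w = J (fst ?v) + B (J (fst ?w))"
      using fstG[OF YT(1)[of t u]] by (simp add: YT(2))
    moreover have "B (J (fst ?w)) \<in> domB" using mem domA by (auto simp: square_domain_def)
    ultimately have "B (snd ?w) = B (J (fst ?v)) + B (B (J (fst ?w)))"
      using JdomB by (simp add: Badd)
    then show ?thesis
      using sndG[of ?w] by (simp add: S YT(2) algebra_simps)
  qed
  have SYdom: "S t (J u) \<in> domA" for t u
    using YT(1)[of t u] by (auto simp: S G_domain_def)

  \<comment> \<open>The cosine family on the domain of \<open>A\<close>\<close>
  have domA_facts: "C' t x = J (fst (T t (0, A x)))" "C t x \<in> domA"
    "A (C t x) = snd (T t (0, A x)) + B (J (fst (T t (0, A x))))" if x: "x \<in> domA" for t x
  proof -
    obtain u where u: "x = J u" using x domA by blast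
    have D: "(u, B x) \<in> ?D" using x BdomA by (auto simp: G_domain_def u)
    \<comment> \<open>With second entry \<open>B x\<close> the first row vanishes and the square of
      \<open>B\<close> cancels in the second, leaving only \<open>A x\<close>.\<close>
    have "?G (u, B x) = (0, A x)"
      using J.zero invJ[of 0] by (simp add: G_op_def u)
    with generator_commute[OF gen D, of t] have TD: "T t (u, B x) \<in> ?D"
      and G: "?G (T t (u, B x)) = T t (0, A x)" by simp_all
    let ?w = "T t (u, B x)" and ?v = "T t (0, A x)"
    have f: "J (fst ?v) = snd ?w - B (J (fst ?w))"
      using fstG[OF TD] by (simp add: G)
    then show "C' t x = J (fst ?v)" by (simp add: u C'Y)
    show mem: "C t x \<in> domA" using TD by (auto simp: u CY G_domain_def)
    have "B (C t x) \<in> domB" using mem domA by (auto simp: square_domain_def)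
    moreover have "snd ?w = J (fst ?v) + B (C t x)" using f by (simp add: u CY)
    ultimately have "B (snd ?w) = B (J (fst ?v)) + B (B (C t x))"
      using JdomB by (simp add: Badd)
    then show "A (C t x) = snd ?v + B (J (fst ?v))"
      using sndG[of ?w] by (simp add: G[unfolded u] u CY algebra_simps)
  qed

  \<comment> \<open>Constants and norm estimates\<close>
  define L where "L = 2 * (1 + K) * (1 + K)"
  \<comment> \<open>\<open>L\<close> dominates every coefficient that occurs below, the largest
    being \<open>(1 + K) * (1 + K)\<close> from \<open>sndBT\<close> followed by
    \<open>lift\<close>, and \<open>2 * (1 + K)\<close> from \<open>Cbound\<close>. The summand 1
    keeps \<open>M'\<close> positive even for \<open>M = 0\<close>.\<close>
  define M' where "M' = L * M + 1"
  have M0: "M \<ge> 0" using E0[of 0] by (simp add: E_def)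
  have M'_pos: "M' > 0" using M0 K by (simp add: M'_def L_def add_nonneg_pos)
  have up: "a \<le> M' * exp (\<omega> * \<bar>t\<bar>) * r" if "a \<le> c * (E t * r)" "c \<le> L" "0 \<le> r" for a c r t
  proof -
    have "a \<le> L * (E t * r)"
      using that E0[of t] mult_right_mono[of c L "E t * r"] by simp
    also have "\<dots> \<le> M' * exp (\<omega> * \<bar>t\<bar>) * r"
      using that(3) by (simp add: E_def M'_def algebra_simps)
    finally show ?thesis .
  qed
  have L: "1 \<le> L" "K \<le> L" "1 + K \<le> L" "(1 + K) * (1 + K) \<le> L" "K * (1 + K) \<le> L"
    using K by (simp_all add: L_def algebra_simps)
  have fstT: "norm (fst (T t z)) \<le> 1 * (E t * (norm (fst z) + norm (snd z)))"
    and sndT: "norm (snd (T t z)) \<le> 1 * (E t * (norm (fst z) + norm (snd z)))" for t z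
    using TE[of t z] by (simp_all add: add_increasing add_increasing2 order_trans[rotated])
  have BT: "norm (B (J (fst (T t z)))) \<le> K * (E t * (norm (fst z) + norm (snd z)))" for t z
    using order_trans[OF BK mult_left_mono[OF fstT[of t z]]] K by simp
  have JT: "norm (J (fst (T t z))) \<le> K * (E t * (norm (fst z) + norm (snd z)))" for t z
    using order_trans[OF JK mult_left_mono[OF fstT[of t z]]] K by simp
  have sndBT: "norm (snd (T t z) - B (J (fst (T t z)))) \<le> (1 + K) * (E t * (norm (fst z) + norm (snd z)))"
    "norm (snd (T t z) + B (J (fst (T t z)))) \<le> (1 + K) * (E t * (norm (fst z) + norm (snd z)))" for t z
    using norm_triangle_le_diff[OF add_mono[OF sndT[of t z] BT[of t z]]]
      norm_triangle_le[OF add_mono[OF sndT[of t z] BT[of t z]]]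
    by (simp_all add: distrib_right)
  \<comment> \<open>Initial data \<open>(u, B (J u))\<close>, with either sign of the second entry,
    are controlled by the Y-norm of \<open>u\<close> at the cost of a factor
    \<open>1 + K\<close>.\<close>
  have lift: "a \<le> c * (1 + K) * (E t * norm u)"
    if "a \<le> c * (E t * (norm u + norm (B (J u))))" "0 \<le> c" for a c t u
  proof -
    have "E t * (norm u + norm (B (J u))) \<le> E t * ((1 + K) * norm u)"
      using BK[of u] E0 by (intro mult_left_mono) (auto simp: distrib_right)
    from order_trans[OF that(1) mult_left_mono[OF this that(2)]] show ?thesis
      by (simp add: ac_simps)
  qed
  \<comment> \<open>\<open>C t x\<close> is the vector bounded by \<open>sndBT\<close> plus twice a
    sine term; the coefficients \<open>1 + K\<close> and \<open>2 * K\<close> are both at most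
    \<open>2 * (1 + K)\<close>.\<close>
  have Cbound: "norm (C t x) \<le> 2 * (1 + K) * (E t * graph_norm B x)" for t x
  proof -
    have "norm (C t x) \<le> norm (snd (T t (0, x)) - B (J (fst (T t (0, x)))))
        + 2 * norm (J (fst (T t (0, B x))))"
      unfolding C by (rule order_trans[OF norm_triangle_ineq]) simp
    also have "\<dots> \<le> (1 + K) * (E t * norm x) + 2 * (K * (E t * norm (B x)))"
      using sndBT(1)[of t "(0, x)"] JT[of t "(0, B x)"] by simp
    also have "\<dots> \<le> 2 * (1 + K) * (E t * graph_norm B x)"
      using K E0[of t] by (simp add: graph_norm_def algebra_simps)
    finally show ?thesis .
  qed

  \<comment> \<open>Collecting the estimates\<close>
  have "S t x \<in> range J \<and> emb_norm J (S t x) \<le> M' * exp (\<omega> * \<bar>t\<bar>) * norm x \<and>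
         norm (B (S t x)) \<le> M' * exp (\<omega> * \<bar>t\<bar>) * norm x \<and>
         (\<lambda>s. S s x) differentiable (at t) \<and>
         norm (S' t x) \<le> M' * exp (\<omega> * \<bar>t\<bar>) * norm x" for t x
    using up[OF fstT[of t "(0, x)"]] up[OF BT[of t "(0, x)"]] up[OF sndBT(1)[of t "(0, x)"]] L Sdiff
    by (simp add: S emb_norm_def S')
  moreover have "norm (B (S t (B (J u)))) \<le> M' * exp (\<omega> * \<bar>t\<bar>) * norm u" for t u
  proof (rule up)
    show "norm (B (S t (B (J u)))) \<le> K * (1 + K) * (E t * norm u)"
      by (rule lift) (use BT[of t "(0, B (J u))"] K E0[of t] in
          \<open>auto simp: S distrib_left intro: add_increasing\<close>)
  qed (use L in auto)
  moreover have "norm (A (S t (J u))) \<le> M' * exp (\<omega> * \<bar>t\<bar>) * norm u"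
    "norm (C' t (J u)) \<le> M' * exp (\<omega> * \<bar>t\<bar>) * norm u" for t u
    using up[OF lift[OF sndBT(2)[of t "(u, - B (J u))", simplified]]]
      up[OF lift[OF sndBT(1)[of t "(u, B (J u))", simplified]]] L K
    by (simp_all add: ASY C'Y)
  \<comment> \<open>The coefficient before \<open>lift\<close> is \<open>1\<close> for the two
    Y-norms and \<open>K\<close> once \<open>B\<close> is applied.\<close>
  moreover have "emb_norm J (S' t (J u)) \<le> M' * exp (\<omega> * \<bar>t\<bar>) * norm u"
    "emb_norm J (C t (J u)) \<le> M' * exp (\<omega> * \<bar>t\<bar>) * norm u"
    "norm (B (C t (J u))) \<le> M' * exp (\<omega> * \<bar>t\<bar>) * norm u" for t u
    using up[OF lift[of _ 1 t u]] up[OF lift[of _ K t u]] L K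
      fstT[of t "(u, - B (J u))"] fstT[of t "(u, B (J u))"] BT[of t "(u, B (J u))"]
    by (simp_all add: S'Y CY emb_norm_def)
  moreover have "norm (C t x) \<le> M' * exp (\<omega> * \<bar>t\<bar>) * graph_norm B x" for t x
    using up[OF Cbound] K by (simp add: L_def graph_norm_def)
  \<comment> \<open>The Y-norm of \<open>C' t x\<close> is that of the first component of
    \<open>T t (0, A x)\<close>, so the growth bound applies directly and \<open>M\<close> itself
    suffices.\<close>
  moreover have "emb_norm J (C' t x) \<le> M * exp (\<omega> * \<bar>t\<bar>) * norm (A x)"
    "norm (A (C t x)) \<le> M' * exp (\<omega> * \<bar>t\<bar>) * norm (A x)" if "x \<in> domA" for t x
    using fstT[of t "(0, A x)"] up[OF sndBT(2)[of t "(0, A x)"]] L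
    by (simp_all add: domA_facts that emb_norm_def E_def)
  ultimately show ?thesis
    using M'_pos
    by (intro exI[of _ M']) (auto simp: SYdom S'Y CY Cdiff[unfolded CY] domA_facts emb_norm_def[of J "J _"])
qed

end
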